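(* Let $\delta\in(0,1]$, let $f:\mathbb{R}^d\to\mathbb{R}$ be convex, differentiable and $L$-smooth, let $\bm x^*\in\arg\min_{\bm x\in\mathcal{D}}f(\bm x)$, and let $(\bm x_t)_{t\ge0}$ be generated by DMO-FW-II. Then for any $t\ge1$, the primal error of DMO-FW-II satisfies $$h(\bm x_t)=f(\bm x_t)-f(\bm x^* )\le\frac{8LC^2}{\delta^2(t+2)},$$ where $\bm x_t\in\mathcal{D}/\delta$.
   Context: Setting: $\mathbb{M}=\{S_1,\dots,S_m\}$ is a collection of subsets of $[d]=\{1,\dots,d\}$ with $\bigcup_iS_i=[d]$ (each $S_i$ being associated with a subgraph of an underlying graph on $[d]$), $C>0$, and $$\mathcal{D}=\operatorname{conv}\{\bm x\in\mathbb{R}^d:\|\bm x\|_2\le C,\ \operatorname{supp}(\bm x)\subseteq S\text{ for some }S\in\mathbb{M}\},\qquad \mathcal{D}/\delta=\{\bm x/\delta:\bm x\in\mathcal{D}\},$$ where $\operatorname{supp}(\bm x)=\{i:x_i\ne0\}$. For $S\subseteq[d]$, $\bm z_S$ keeps the entries of $\bm z$ indexed by $S$ and sets the others to $0$. $f$ is $L$-smooth ($L>0$) if $f(\bm x)-f(\bm y)-\langle\nabla f(\bm y),\bm x-\bm y\rangle\le\frac L2\|\bm x-\bm y\|_2^2$ for all $\bm x,\bm y\in\mathcal{D}$. For $\delta\in(0,1]$, $S\in(\delta,\bm z,\mathcal{D})$-DMO (approximate dual maximization oracle) means $S\in\mathbb{M}$ and $\|\bm z_S\|_2\ge\delta\max_{S'\in\mathbb{M}}\|\bm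 z_{S'}\|_2$. DMO-FW-II: start from any $\bm x_0\in\mathcal{D}$, use step sizes $\eta_t=2/(t+2)$, and for $t=0,1,\dots$ set $\bm z_t=-\nabla f(\bm x_t)$, take $S_t\in(\delta,-\bm z_t,\mathcal{D})$-DMO, set $\tilde{\bm v}_t=C(\bm z_t)_{S_t}/\|(\bm z_t)_{S_t}\|_2$, and $\bm x_{t+1}=\bm x_t+\eta_t(\tilde{\bm v}_t/\delta-\bm x_t)$.
   Formalization: The L-smoothness inequality is assumed for all x, y in D/δ (where the iterates lie) instead of only in D; with smoothness on D alone the bound fails for δ<1. *)

theory Defs
  imports "HOL-Analysis.Analysis"
begin

text \<open>The index set \<open>[d]\<close> is the finite type \<open>'n\<close>, so vectors live in \<open>real ^ 'n\<close> and the
  family of admissible supports is \<open>M :: 'n set set\<close>, which is automatically finite.\<close>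

definition supp :: "real ^ 'n \<Rightarrow> 'n set" where
  "supp x = {i. x $ i \<noteq> 0}"

definition restr :: "real ^ 'n \<Rightarrow> 'n set \<Rightarrow> real ^ 'n" where
  "restr z S = (\<chi> i. if i \<in> S then z $ i else 0)"

definition support_hull :: "'n::finite set set \<Rightarrow> real \<Rightarrow> (real ^ 'n) set" where
  "support_hull M C = convex hull {x. norm x \<le> C \<and> (\<exists>S\<in>M. supp x \<subseteq> S)}"

definition scaled_hull :: "'n::finite set set \<Rightarrow> real \<Rightarrow> real \<Rightarrow> (real ^ 'n) set" where
  "scaled_hull M C \<delta> = (\<lambda>x. x /\<^sub>R \<delta>) ` support_hull M C"

text \<open>Meaningful only where \<open>f\<close> is differentiable.\<close>

definition gradient :: "('a::real_inner \<Rightarrow> real) \<Rightarrow> 'a \<Rightarrow> 'a" where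
  "gradient f x = (THE D. GDERIV f x :> D)"

text \<open>The iterates of DMO-FW-II leave \<open>support_hull M C\<close> when \<open>\<delta> < 1\<close>, and smoothness on that set
  alone does not control them; hence the domain \<open>A\<close> is a parameter, to be taken as
  \<open>scaled_hull M C \<delta>\<close>.\<close>

definition smooth_on_set :: "real \<Rightarrow> ('a::real_inner \<Rightarrow> real) \<Rightarrow> 'a set \<Rightarrow> bool" where
  "smooth_on_set L f A \<longleftrightarrow>
     (\<forall>x\<in>A. \<forall>y\<in>A. f x - f y - inner (gradient f y) (x - y) \<le> L / 2 * (norm (x - y))\<^sup>2)"

definition DMO :: "real \<Rightarrow> real ^ 'n \<Rightarrow> 'n::finite set set \<Rightarrow> 'n set set" where
  "DMO \<delta> z M = {S \<in> M. norm (restr z S) \<ge> \<delta> * Max ((\<lambda>S'. norm (restr z S')) ` M)}"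

text \<open>\<open>dmo_fw_ii M C \<delta> f x\<close>: the sequence \<open>x\<close> is a possible run of DMO-FW-II.  The oracle may
  return any admissible set, so a run is a relation and not a function of the starting point.
  If \<open>restr z S = 0\<close> the normalisation reads \<open>0 / 0\<close>; here the direction \<open>v\<close> is then \<open>0\<close>.
  When \<open>M\<close> covers the index type, this happens only if \<open>gradient f (x t) = 0\<close>.\<close>

definition dmo_fw_ii ::
  "'n::finite set set \<Rightarrow> real \<Rightarrow> real \<Rightarrow> (real ^ 'n \<Rightarrow> real) \<Rightarrow> (nat \<Rightarrow> real ^ 'n) \<Rightarrow> bool" where
  "dmo_fw_ii M C \<delta> f x \<longleftrightarrow>
     x 0 \<in> support_hull M C \<and>
     (\<forall>t. let \<eta> = 2 / (real t + 2); z = - gradient f (x t) in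
        \<exists>S \<in> DMO \<delta> (- z) M.
          let v = (C / norm (restr z S)) *\<^sub>R restr z S in
          x (Suc t) = x t + \<eta> *\<^sub>R (v /\<^sub>R \<delta> - x t))"

end

theory Submission
  imports Defs
begin

text \<open>
  Write \<open>D\<close> for \<open>support_hull M C\<close>.  Given an oracle answer \<open>S\<close> at \<open>z = - gradient f (x t)\<close>,
  the point \<open>v = C z\<^sub>S / \<parallel>z\<^sub>S\<parallel>\<close> maximizes the linearized problem up to a multiplicative loss: \<open>\<langle>z, v\<rangle> = C \<parallel>z\<^sub>S\<parallel> \<ge> \<delta> max\<^sub>y \<langle>z, y\<rangle>\<close> over \<open>y \<in> D\<close>, because by
  Cauchy--Schwarz that maximum is at most \<open>C\<close> times the largest norm of a restriction of \<open>z\<close>.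
  Dividing by \<open>\<delta>\<close>, the point \<open>v / \<delta>\<close> of \<open>D / \<delta>\<close> is at least as good for the linearized problem
  as every point of \<open>D\<close>, in particular as the minimizer (lemma \<open>scaled_DMO_direction_dominates\<close>).

  The algorithm is therefore an ordinary Frank--Wolfe method whose iterates move in the enlarged
  set \<open>D / \<delta>\<close>, of radius \<open>C / \<delta>\<close>, while the benchmark stays in \<open>D\<close>.  Smoothness
  (\<open>smooth_segment_upper_bound\<close>) and the tangent inequality for convex functions
  (\<open>convex_above_tangent_gradient\<close>) give the recurrence
  \<open>h (t + 1) \<le> (1 - \<eta>\<^sub>t) h t + 2 L (C / \<delta>)\<^sup>2 \<eta>\<^sub>t\<^sup>2\<close> for the primal error, and
  \<open>frank_wolfe_recurrence_bound\<close> solves it for \<open>\<eta>\<^sub>t = 2 / (t + 2)\<close>.  Since \<open>\<eta>\<^sub>0 = 1\<close>, the error of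
  the starting point is forgotten after one step.
\<close>

section \<open>Gradients of convex and of smooth functions\<close>

lemma GDERIV_gradient:
  fixes f :: "'a::euclidean_space \<Rightarrow> real"
  assumes "f differentiable (at x)"
  shows "GDERIV f x :> gradient f x"
proof -
  obtain f' where f': "(f has_derivative f') (at x)"
    using assms by (auto simp: differentiable_def)
  then have lin: "linear f'"
    by (rule has_derivative_linear)
  \<comment> \<open>The Riesz representative of the derivative, in coordinates.\<close>
  define D where "D = (\<Sum>b\<in>Basis. f' b *\<^sub>R b)"
  have "f' h = inner h D" for h
  proof -
    have "f' h = f' (\<Sum>b\<in>Basis. inner h b *\<^sub>R b)"
      by (simp add: euclidean_representation)
    also have "\<dots> = inner h D"
      unfolding D_def inner_sum_right
      by (simp add: linear_sum[OF lin] linear_cmul[OF lin] mult.commute)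
    finally show ?thesis .
  qed
  then have "f' = (\<lambda>h. inner h D)" by auto
  then have D: "GDERIV f x :> D"
    using f' by (simp add: gderiv_def)
  have "E = D" if E: "GDERIV f x :> E" for E
  proof -
    have "(\<lambda>h. inner h E) = (\<lambda>h. inner h D)"
      using has_derivative_unique[of f _ x] D E unfolding gderiv_def by blast
    then have "inner h (E - D) = 0" for h
      by (metis inner_diff_right right_minus_eq)
    then show ?thesis
      by (metis inner_eq_zero_iff right_minus_eq)
  qed
  with D show ?thesis
    unfolding gradient_def by (rule theI)
qed

text \<open>Along the segment from \<open>x\<close> to \<open>y\<close> the function is a convex function of one real variable
  whose derivative at the start is the inner product below, so the one-dimensional tangent
  inequality applies.\<close>

lemma convex_above_tangent_gradient:
  fixes f :: "'a::euclidean_space \<Rightarrow> real"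
  assumes conv: "convex_on UNIV f" and diff: "f differentiable (at x)"
  shows "f x + inner (gradient f x) (y - x) \<le> f y"
proof -
  let ?g = "\<lambda>s::real. f (x + s *\<^sub>R (y - x))"
  have convg: "convex_on UNIV ?g"
  proof (rule convex_onI)
    fix t a b :: real
    assume t: "0 < t" "t < 1"
    have "x + ((1 - t) *\<^sub>R a + t *\<^sub>R b) *\<^sub>R (y - x) =
        (1 - t) *\<^sub>R (x + a *\<^sub>R (y - x)) + t *\<^sub>R (x + b *\<^sub>R (y - x))"
      by (simp add: algebra_simps)
    then show "?g ((1 - t) *\<^sub>R a + t *\<^sub>R b) \<le> (1 - t) * ?g a + t * ?g b"
      using convex_onD[OF conv, of t "x + a *\<^sub>R (y - x)" "x + b *\<^sub>R (y - x)"] t by simp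
  qed auto
  have df: "(f has_derivative (\<lambda>h. inner h (gradient f x))) (at (x + 0 *\<^sub>R (y - x)))"
    using GDERIV_gradient[OF diff] by (simp add: gderiv_def)
  have "((\<lambda>s::real. x + s *\<^sub>R (y - x)) has_derivative (\<lambda>s. s *\<^sub>R (y - x))) (at 0)"
    by (auto intro!: derivative_eq_intros)
  from has_derivative_compose[OF this df]
  have "(?g has_derivative (\<lambda>s. s * inner (gradient f x) (y - x))) (at 0)"
    by (simp add: inner_commute)
  then have der: "(?g has_real_derivative inner (gradient f x) (y - x)) (at 0)"
    by (simp only: has_field_derivative_def mult_commute_abs)
  show ?thesis
    using convex_on_imp_above_tangent[OF convg _ _ _ der, of 1] by simp
qed

text \<open>Two points of a set of radius \<open>R\<close> are at distance at most \<open>2 R\<close>, whence the constant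
  \<open>L / 2 \<cdot> (2 R)\<^sup>2 = 2 L R\<^sup>2\<close>.\<close>

lemma smooth_segment_upper_bound:
  assumes smooth: "smooth_on_set L f A" and A: "convex A"
    and bound: "\<And>y. y \<in> A \<Longrightarrow> norm y \<le> R"
    and x: "x \<in> A" and w: "w \<in> A" and \<eta>: "0 \<le> \<eta>" "\<eta> \<le> 1" and L: "0 \<le> L"
  shows "f (x + \<eta> *\<^sub>R (w - x)) \<le> f x + \<eta> * inner (gradient f x) (w - x) + 2 * L * R\<^sup>2 * \<eta>\<^sup>2"
proof -
  let ?y = "x + \<eta> *\<^sub>R (w - x)"
  have "?y = (1 - \<eta>) *\<^sub>R x + \<eta> *\<^sub>R w"
    by (simp add: algebra_simps)
  then have y: "?y \<in> A"
    using convexD_alt[OF A x w \<eta>] by simp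
  have "norm (w - x) \<le> 2 * R"
    using norm_triangle_ineq4[of w x] bound[OF x] bound[OF w] by linarith
  then have "(norm (w - x))\<^sup>2 \<le> (2 * R)\<^sup>2"
    by (rule power_mono) simp
  then have "L / 2 * \<eta>\<^sup>2 * (norm (w - x))\<^sup>2 \<le> L / 2 * \<eta>\<^sup>2 * (2 * R)\<^sup>2"
    using L by (intro mult_left_mono) auto
  moreover have "f ?y - f x - inner (gradient f x) (?y - x) \<le> L / 2 * (norm (?y - x))\<^sup>2"
    using smooth y x unfolding smooth_on_set_def by blast
  moreover have "?y - x = \<eta> *\<^sub>R (w - x)"
    by simp
  ultimately show ?thesis
    by (simp only: inner_scaleR_right norm_scaleR power_mult_distrib power2_abs)
      (simp add: mult_ac)
qed

section \<open>The feasible set and its scaled copy\<close>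

lemma norm_le_if_in_support_hull:
  assumes "y \<in> support_hull M C"
  shows "norm y \<le> C"
proof -
  have "support_hull M C \<subseteq> cball 0 C"
    unfolding support_hull_def by (rule hull_minimal) auto
  with assms show ?thesis by auto
qed

lemma zero_in_support_hull:
  assumes "M \<noteq> {}" "0 \<le> C"
  shows "0 \<in> support_hull M C"
  unfolding support_hull_def using assms by (intro hull_inc) (auto simp: supp_def)

lemma convex_scaled_hull: "convex (scaled_hull M C \<delta>)"
  unfolding scaled_hull_def support_hull_def by (intro convex_scaling convex_convex_hull)

lemma norm_le_if_in_scaled_hull:
  assumes "y \<in> scaled_hull M C \<delta>" "0 < \<delta>"
  shows "norm y \<le> C / \<delta>"
  using assms norm_le_if_in_support_hull[of _ M C]
  by (auto simp: scaled_hull_def divide_simps mult.commute)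

text \<open>Shrinking a point of the hull by \<open>\<delta> \<le> 1\<close> moves it towards the origin, which lies in the
  hull.\<close>

lemma support_hull_subset_scaled_hull:
  assumes "M \<noteq> {}" "0 \<le> C" "0 < \<delta>" "\<delta> \<le> 1"
  shows "support_hull M C \<subseteq> scaled_hull M C \<delta>"
proof
  fix y assume y: "y \<in> support_hull M C"
  have "(1 - \<delta>) *\<^sub>R 0 + \<delta> *\<^sub>R y \<in> support_hull M C"
    by (rule convexD_alt) (use assms y zero_in_support_hull in \<open>auto simp: support_hull_def\<close>)
  then have "\<delta> *\<^sub>R y \<in> support_hull M C"
    by simp
  then have "(\<delta> *\<^sub>R y) /\<^sub>R \<delta> \<in> scaled_hull M C \<delta>"
    unfolding scaled_hull_def by (rule imageI)
  then show "y \<in> scaled_hull M C \<delta>"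
    using assms by simp
qed

section \<open>The direction returned by the oracle\<close>

lemma inner_eq_inner_restr:
  assumes "supp y \<subseteq> S"
  shows "inner z y = inner (restr z S) y"
  unfolding inner_vec_def restr_def
  using assms by (intro sum.cong) (auto simp: supp_def)

lemma supp_restr_subset: "supp (c *\<^sub>R restr z S) \<subseteq> S"
  by (auto simp: supp_def restr_def)

lemma norm_restr_uminus: "norm (restr (- z) S) = norm (restr z S)"
proof -
  have "restr (- z) S = - restr z S"
    by (simp add: restr_def vec_eq_iff)
  then show ?thesis by simp
qed

text \<open>An upper bound of a linear functional on the generators passes to their convex hull, and a
  generator with support in \<open>S\<close> only sees the restriction of \<open>z\<close> to \<open>S\<close>.\<close>

lemma inner_support_hull_le:
  fixes M :: "'n::finite set set"
  assumes y: "y \<in> support_hull M C" and C: "0 \<le> C"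
  shows "inner z y \<le> C * Max ((\<lambda>S. norm (restr z S)) ` M)"
proof -
  let ?m = "Max ((\<lambda>S. norm (restr z S)) ` M)"
  have "support_hull M C \<subseteq> {y. inner z y \<le> C * ?m}"
    unfolding support_hull_def
  proof (rule hull_minimal)
    show "{x. norm x \<le> C \<and> (\<exists>S\<in>M. supp x \<subseteq> S)} \<subseteq> {y. inner z y \<le> C * ?m}"
    proof safe
      fix u S assume u: "norm u \<le> C" and S: "S \<in> M" "supp u \<subseteq> S"
      have "inner z u \<le> norm (restr z S) * norm u"
        using inner_eq_inner_restr[OF S(2)] norm_cauchy_schwarz by metis
      also have "\<dots> \<le> ?m * C"
        using u S C by (intro mult_mono Max_ge order_trans[OF norm_ge_zero Max_ge]) auto
      finally show "inner z u \<le> C * ?m" by (simp add: mult.commute)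
    qed
  qed (rule convex_halfspace_le)
  with y show ?thesis by blast
qed

text \<open>The multiplicative loss \<open>\<delta>\<close> of the oracle is compensated exactly by scaling its
  direction up by \<open>1 / \<delta>\<close>.\<close>

lemma scaled_DMO_direction_dominates:
  fixes M :: "'n::finite set set"
  assumes S: "S \<in> DMO \<delta> (- z) M" and C: "0 \<le> C" and \<delta>: "0 < \<delta>"
    and v: "v = (C / norm (restr z S)) *\<^sub>R restr z S"
    and y: "y \<in> support_hull M C"
  shows "inner z y \<le> inner z (v /\<^sub>R \<delta>)"
proof -
  let ?m = "Max ((\<lambda>S. norm (restr z S)) ` M)"
  have "inner z (restr z S) = (norm (restr z S))\<^sup>2"
    using inner_eq_inner_restr[OF supp_restr_subset[of 1 z S], of z]
    by (simp add: power2_norm_eq_inner)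
  then have zv: "inner z v = C * norm (restr z S)"
    by (simp add: v power2_eq_square)
  have "\<delta> * ?m \<le> norm (restr z S)"
    using S by (simp add: DMO_def norm_restr_uminus)
  then have "C * (\<delta> * ?m) \<le> inner z v"
    unfolding zv using C by (rule mult_left_mono)
  moreover have "\<delta> * inner z y \<le> \<delta> * (C * ?m)"
    using inner_support_hull_le[OF y C, of z] \<delta> by (intro mult_left_mono) auto
  ultimately have "\<delta> * inner z y \<le> inner z v"
    by (simp add: mult_ac)
  then show ?thesis
    using \<delta> by (simp add: field_simps)
qed

lemma scaled_DMO_direction_in_scaled_hull:
  assumes "S \<in> M" "0 \<le> C"
  shows "((C / norm (restr z S)) *\<^sub>R restr z S) /\<^sub>R \<delta> \<in> scaled_hull M C \<delta>"
proof -
  have "(C / norm (restr z S)) *\<^sub>R restr z S \<in> support_hull M C"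
    unfolding support_hull_def
    by (intro hull_inc CollectI conjI bexI[where x = S] supp_restr_subset) (use assms in auto)
  then show ?thesis
    unfolding scaled_hull_def by (rule imageI)
qed

section \<open>Convergence rate\<close>

text \<open>The factor \<open>t / (t + 2)\<close> vanishes for \<open>t = 0\<close>, which gives \<open>h 1 \<le> K / 4\<close>; from then on
  the bound is preserved because \<open>(t + 1) (t + 3) \<le> (t + 2)\<^sup>2\<close>.\<close>

lemma frank_wolfe_recurrence_bound:
  fixes h :: "nat \<Rightarrow> real"
  assumes rec: "\<And>t. h (Suc t) \<le> real t / (real t + 2) * h t + K / (real t + 2)\<^sup>2"
    and K: "0 \<le> K" and "1 \<le> t"
  shows "h t \<le> K / (real t + 2)"
  using \<open>1 \<le> t\<close>
proof (induction t rule: dec_induct)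
  case base
  show ?case
    using rec[of 0] K by (simp add: power2_eq_square)
next
  case (step t)
  let ?s = "real t + 2"
  have "h (Suc t) \<le> real t / ?s * h t + K / ?s\<^sup>2"
    by (rule rec)
  also have "\<dots> \<le> real t / ?s * (K / ?s) + K / ?s\<^sup>2"
    using step.IH by (intro add_right_mono mult_left_mono) auto
  also have "\<dots> = K * ((real t + 1) / ?s\<^sup>2)"
    by (simp add: power2_eq_square field_simps add_divide_distrib)
  also have "\<dots> \<le> K * (1 / (real (Suc t) + 2))"
  proof (intro mult_left_mono K)
    have "(real t + 1) * (real (Suc t) + 2) \<le> ?s\<^sup>2"
      by (simp add: power2_eq_square algebra_simps)
    then show "(real t + 1) / ?s\<^sup>2 \<le> 1 / (real (Suc t) + 2)"
      by (subst frac_le_eq) (auto simp: divide_nonpos_pos)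
  qed
  finally show ?case by simp
qed

theorem theorem5p4:
  fixes M :: "'n::finite set set"
    and C L \<delta> :: real
    and f :: "real ^ 'n \<Rightarrow> real"
    and xstar :: "real ^ 'n"
    and x :: "nat \<Rightarrow> real ^ 'n"
    and t :: nat
  assumes "\<Union>M = UNIV"
    and "C > 0"
    and "L > 0"
    and "0 < \<delta>" and "\<delta> \<le> 1"
    and "convex_on UNIV f"
    and "\<And>y. f differentiable (at y)"
    and "smooth_on_set L f (scaled_hull M C \<delta>)"
    and "is_arg_min f (\<lambda>y. y \<in> support_hull M C) xstar"
    and "dmo_fw_ii M C \<delta> f x"
    and "t \<ge> 1"
  shows "x t \<in> scaled_hull M C \<delta> \<and>
         f (x t) - f xstar \<le> 8 * L * C\<^sup>2 / (\<delta>\<^sup>2 * (real t + 2))"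
proof -
  let ?A = "scaled_hull M C \<delta>" and ?\<eta> = "\<lambda>t. 2 / (real t + 2)"
  have M: "M \<noteq> {}"
    using assms(1) by auto
  have \<eta>: "0 \<le> ?\<eta> t" "?\<eta> t \<le> 1" for t
    by (auto simp: field_simps)
  have xstar: "xstar \<in> support_hull M C"
    using assms(9) by (simp add: is_arg_min_def)
  have run: "\<exists>w\<in>?A. x (Suc t) = x t + ?\<eta> t *\<^sub>R (w - x t) \<and>
      inner (- gradient f (x t)) xstar \<le> inner (- gradient f (x t)) w" for t
  proof -
    let ?z = "- gradient f (x t)"
    obtain S where S: "S \<in> DMO \<delta> (- ?z) M"
      and step: "x (Suc t) =
        x t + ?\<eta> t *\<^sub>R (((C / norm (restr ?z S)) *\<^sub>R restr ?z S) /\<^sub>R \<delta> - x t)"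
      using assms(10) unfolding dmo_fw_ii_def Let_def by blast
    have "S \<in> M"
      using S by (simp add: DMO_def)
    then show ?thesis
      using scaled_DMO_direction_in_scaled_hull[OF \<open>S \<in> M\<close>, of C \<delta> ?z]
        scaled_DMO_direction_dominates[OF S _ assms(4) refl xstar] step \<open>C > 0\<close>
      by (intro bexI[of _ "((C / norm (restr ?z S)) *\<^sub>R restr ?z S) /\<^sub>R \<delta>"]) auto
  qed
  have x_in: "x t \<in> ?A" for t
  proof (induction t)
    case 0
    have "x 0 \<in> support_hull M C"
      using assms(10) by (simp add: dmo_fw_ii_def)
    then show ?case
      using support_hull_subset_scaled_hull[OF M _ assms(4,5), of C] \<open>C > 0\<close> by auto
  next
    case (Suc t)
    obtain w where w: "w \<in> ?A" "x (Suc t) = x t + ?\<eta> t *\<^sub>R (w - x t)"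
      using run by blast
    then have "x (Suc t) = (1 - ?\<eta> t) *\<^sub>R x t + ?\<eta> t *\<^sub>R w"
      by (simp add: algebra_simps)
    then show ?case
      using convexD_alt[OF convex_scaled_hull Suc w(1) \<eta>] by simp
  qed
  define h where "h t = f (x t) - f xstar" for t
  define K where "K = 8 * L * (C / \<delta>)\<^sup>2"
  have "h (Suc t) \<le> real t / (real t + 2) * h t + K / (real t + 2)\<^sup>2" for t
  proof -
    obtain w where w: "w \<in> ?A" and step: "x (Suc t) = x t + ?\<eta> t *\<^sub>R (w - x t)"
      and dom: "inner (- gradient f (x t)) xstar \<le> inner (- gradient f (x t)) w"
      using run by blast
    have "inner (gradient f (x t)) (w - x t) \<le> inner (gradient f (x t)) (xstar - x t)"
      using dom by (simp add: inner_diff_right)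
    also have "\<dots> \<le> f xstar - f (x t)"
      using convex_above_tangent_gradient[OF assms(6,7), of "x t" xstar] by simp
    finally have gap: "inner (gradient f (x t)) (w - x t) \<le> - h t"
      by (simp add: h_def)
    have "f (x (Suc t)) \<le> f (x t) + ?\<eta> t * inner (gradient f (x t)) (w - x t)
        + 2 * L * (C / \<delta>)\<^sup>2 * (?\<eta> t)\<^sup>2"
      unfolding step
      by (rule smooth_segment_upper_bound[OF assms(8) convex_scaled_hull _ x_in w \<eta>])
        (use norm_le_if_in_scaled_hull assms(3,4) in auto)
    then have "h (Suc t) \<le> h t + ?\<eta> t * (- h t) + 2 * L * (C / \<delta>)\<^sup>2 * (?\<eta> t)\<^sup>2"
      using mult_left_mono[OF gap \<eta>(1)[of t]] unfolding h_def by linarith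
    also have "h t + ?\<eta> t * (- h t) = real t / (real t + 2) * h t"
      by (simp add: field_simps)
    also have "2 * L * (C / \<delta>)\<^sup>2 * (?\<eta> t)\<^sup>2 = K / (real t + 2)\<^sup>2"
      by (simp add: K_def power_divide)
    finally show ?thesis .
  qed
  then have "h t \<le> K / (real t + 2)"
    by (rule frank_wolfe_recurrence_bound) (use assms(3,11) in \<open>auto simp: K_def\<close>)
  then show ?thesis
    using x_in by (simp add: h_def K_def power_divide)
qed

end
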